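(* For every integer $k \ge 1$, there exists a quasi-perfect $1$-error-correcting code in each of the following Cartesian products: (1) $C_6 \square C_6 \square C_{3k}$; (2) $C_n \square C_n \square C_{3k}$ for every $n$ with $8 \le n \le 12$; (3) $C_n \square C_n \square C_n$ for every $n$ with $8 \le n \le 12$.
   Context: All graphs are simple and connected; $d(x,y)$ is the shortest-path distance. For $n\ge 3$, $C_n$ is the cycle on $n$ vertices. The Cartesian product $G\square H$ has vertex set $V(G)\times V(H)$, with $(g_1,h_1)$ adjacent to $(g_2,h_2)$ iff either $h_1=h_2$ and $g_1g_2\in E(G)$, or $g_1=g_2$ and $h_1h_2\in E(H)$. A code is a subset $D$ of the vertex set. $D$ is $t$-error-correcting if any two distinct codewords are at distance at least $2t+1$. The covering radius of $D$ is the smallest $r$ such that every vertex is at distance at most $r$ from some codeword. A quasi-perfect $t$-error-correcting code is a $t$-error-correcting code with covering radius $t+1$. *)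

theory Defs
  imports "Graph_Theory.Graph_Theory" "HOL-Library.Extended_Nat"
begin

text \<open>
  Simple graphs are represented, as in Graph_Theory, by finite symmetric loop-free
  pair digraphs (locale \<^locale>\<open>pair_graph\<close>).
\<close>

definition cycle_graph :: "nat \<Rightarrow> nat pair_pre_digraph" where
  "cycle_graph n =
     \<lparr> pverts = {0..<n},
       parcs = {(u, v). u < n \<and> v < n \<and> (v = (u + 1) mod n \<or> u = (v + 1) mod n)} \<rparr>"

definition cart_prod ::
    "'a pair_pre_digraph \<Rightarrow> 'b pair_pre_digraph \<Rightarrow> ('a \<times> 'b) pair_pre_digraph"
    (infixl "\<box>" 70) where
  "G \<box> H =
     \<lparr> pverts = pverts G \<times> pverts H,
       parcs = {((g1, h1), (g2, h2)).
          (h1 \<in> pverts H \<and> h1 = h2 \<and> (g1, g2) \<in> parcs G) \<or>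
          (g1 \<in> pverts G \<and> g1 = g2 \<and> (h1, h2) \<in> parcs H)} \<rparr>"

text \<open>Shortest-path distance: all arcs have weight 1.\<close>

definition graph_dist :: "'a pair_pre_digraph \<Rightarrow> 'a \<Rightarrow> 'a \<Rightarrow> ereal" where
  "graph_dist G u v = wf_digraph.\<mu> (with_proj G) (\<lambda>_. 1) u v"

definition error_correcting :: "'a pair_pre_digraph \<Rightarrow> nat \<Rightarrow> 'a set \<Rightarrow> bool" where
  "error_correcting G t D \<longleftrightarrow>
     D \<subseteq> pverts G \<and>
     (\<forall>x\<in>D. \<forall>y\<in>D. x \<noteq> y \<longrightarrow> ereal (real (2 * t + 1)) \<le> graph_dist G x y)"

text \<open>The infimum is the smallest such radius; it is \<open>\<infinity>\<close> if there is none, e.g. for the empty code.\<close>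

definition covering_radius :: "'a pair_pre_digraph \<Rightarrow> 'a set \<Rightarrow> enat" where
  "covering_radius G D =
     Inf {enat r | r. \<forall>v\<in>pverts G. \<exists>c\<in>D. graph_dist G v c \<le> ereal (real r)}"

definition quasi_perfect :: "'a pair_pre_digraph \<Rightarrow> nat \<Rightarrow> 'a set \<Rightarrow> bool" where
  "quasi_perfect G t D \<longleftrightarrow> error_correcting G t D \<and> covering_radius G D = enat (t + 1)"

lemma pair_graph_cycle_graph:
  assumes "n \<ge> 3"
  shows "pair_graph (cycle_graph n)"
proof
  show "finite (parcs (cycle_graph n))"
    by (rule finite_subset[of _ "{0..<n} \<times> {0..<n}"]) (auto simp: cycle_graph_def)
  show "symmetric (with_proj (cycle_graph n))"
    by (auto simp: cycle_graph_def symmetric_def sym_def)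
  have "(u + 1) mod n \<noteq> u" if "u < n" for u
    using that assms by (cases "u + 1 = n") auto
  then show "fst e \<noteq> snd e" if "e \<in> parcs (cycle_graph n)" for e
    using that by (fastforce simp: cycle_graph_def)
qed (auto simp: cycle_graph_def)

lemma pair_graph_cart_prod:
  assumes "pair_graph G" "pair_graph H"
  shows "pair_graph (G \<box> H)"
proof -
  interpret G: pair_graph G by fact
  interpret H: pair_graph H by fact
  show ?thesis
  proof
    show "finite (parcs (G \<box> H))"
      by (rule finite_subset[of _ "(pverts G \<times> pverts H) \<times> (pverts G \<times> pverts H)"])
        (auto simp: cart_prod_def G.pair_finite_verts H.pair_finite_verts
           dest: G.wellformed' H.wellformed')
    show "symmetric (with_proj (G \<box> H))"
      using G.pair_sym_arcs H.pair_sym_arcs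
      by (auto simp: cart_prod_def symmetric_def sym_def)
    show "fst e \<noteq> snd e" if "e \<in> parcs (G \<box> H)" for e
      using that G.pair_no_loops H.pair_no_loops by (fastforce simp: cart_prod_def)
    show "fst e \<in> pverts (G \<box> H)" if "e \<in> parcs (G \<box> H)" for e
      using that by (auto simp: cart_prod_def dest: G.wellformed' H.wellformed')
    show "snd e \<in> pverts (G \<box> H)" if "e \<in> parcs (G \<box> H)" for e
      using that by (auto simp: cart_prod_def dest: G.wellformed' H.wellformed')
  qed (auto simp: cart_prod_def G.pair_finite_verts H.pair_finite_verts)
qed

lemma graph_dist_eq:
  assumes "pair_graph G"
  shows "graph_dist G u v =
    (INF p\<in>{p. pre_digraph.awalk (with_proj G) u p v}. ereal (real (length p)))"
proof -
  interpret pair_graph G by fact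
  have "awalk_cost (\<lambda>_. 1) p = real (length p)" for p :: "('a \<times> 'a) list"
    by (induction p) auto
  then show ?thesis
    unfolding graph_dist_def wf_digraph.\<mu>_def[OF wf_digraph] by simp
qed

end

theory Submission
  imports Defs
begin

text \<open>
  A maximal 1-error-correcting code has covering radius at most 2: a vertex at distance at least 3
  from all codewords could be added. So it suffices to find a 1-error-correcting set \<open>S\<close> and
  a vertex \<open>v\<close> such that no element of \<open>S\<close> is within distance 1 of \<open>v\<close>, while every vertex within
  distance 1 of \<open>v\<close> is within distance 2 of \<open>S\<close>; then no 1-error-correcting code containing \<open>S\<close>
  covers \<open>v\<close> with radius 1. Around \<open>v = (0,0,0)\<close> in a product of three cycles,
  \<open>S = {(1,1,0), (-1,0,1), (0,-1,-1)}\<close> does this: its elements differ pairwise in all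
  three coordinates, and each of the six neighbours of \<open>v\<close> is adjacent to an element of \<open>S\<close>.
  Only the fact that each factor has a vertex of degree 2 matters.
\<close>

section \<open>Distance bounds in terms of walk lengths\<close>

lemma Suc_le_graph_dist:
  assumes "pair_graph G"
    and "\<And>p. pre_digraph.awalk (with_proj G) u p v \<Longrightarrow> \<not> length p \<le> r"
  shows "ereal (real (Suc r)) \<le> graph_dist G u v"
  unfolding graph_dist_eq[OF assms(1)]
proof (rule INF_greatest)
  fix p assume "p \<in> {p. pre_digraph.awalk (with_proj G) u p v}"
  then have "Suc r \<le> length p" using assms(2)[of p] by simp
  then show "ereal (real (Suc r)) \<le> ereal (real (length p))"
    by (simp only: ereal_less_eq of_nat_le_iff)
qed

text \<open>Walk lengths are natural numbers, so if every walk is longer than \<open>r\<close>, the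
  infimum is at least \<open>r + 1\<close>; with no walk at all it is infinite.\<close>

lemma graph_dist_le_iff:
  assumes "pair_graph G"
  shows "graph_dist G u v \<le> ereal (real r) \<longleftrightarrow>
    (\<exists>p. pre_digraph.awalk (with_proj G) u p v \<and> length p \<le> r)"
proof
  assume le: "graph_dist G u v \<le> ereal (real r)"
  show "\<exists>p. pre_digraph.awalk (with_proj G) u p v \<and> length p \<le> r"
  proof (rule ccontr)
    assume "\<not> ?thesis"
    then have "ereal (real (Suc r)) \<le> graph_dist G u v"
      by (intro Suc_le_graph_dist[OF assms]) blast
    from order_trans[OF this le] show False by simp
  qed
next
  assume "\<exists>p. pre_digraph.awalk (with_proj G) u p v \<and> length p \<le> r"
  then obtain p where "pre_digraph.awalk (with_proj G) u p v" "length p \<le> r" by blast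
  then show "graph_dist G u v \<le> ereal (real r)"
    unfolding graph_dist_eq[OF assms] by (intro INF_lower2[of p]) auto
qed

lemma Suc_le_graph_dist_iff:
  assumes "pair_graph G"
  shows "ereal (real (Suc r)) \<le> graph_dist G u v \<longleftrightarrow> \<not> graph_dist G u v \<le> ereal (real r)"
proof
  assume le: "ereal (real (Suc r)) \<le> graph_dist G u v"
  show "\<not> graph_dist G u v \<le> ereal (real r)"
  proof
    assume "graph_dist G u v \<le> ereal (real r)"
    from order_trans[OF le this] show False by simp
  qed
next
  assume "\<not> graph_dist G u v \<le> ereal (real r)"
  then show "ereal (real (Suc r)) \<le> graph_dist G u v"
    using graph_dist_le_iff[OF assms] by (intro Suc_le_graph_dist[OF assms]) blast
qed

section \<open>Balls of radius 1 and 2\<close>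

text \<open>Distance at most 1. The equality case asks for a vertex because the empty walk exists
  only at vertices.\<close>

definition near :: "'a pair_pre_digraph \<Rightarrow> 'a \<Rightarrow> 'a \<Rightarrow> bool" where
  "near G u v \<longleftrightarrow> u \<in> pverts G \<and> u = v \<or> (u, v) \<in> parcs G"

text \<open>Distance at most 2; shorter distances are included because \<open>near\<close> is
  reflexive on vertices.\<close>

definition near2 :: "'a pair_pre_digraph \<Rightarrow> 'a \<Rightarrow> 'a \<Rightarrow> bool" where
  "near2 G u v \<longleftrightarrow> (\<exists>w. near G u w \<and> near G w v)"

lemma near_sym:
  assumes "pair_graph G" "near G u v"
  shows "near G v u"
proof -
  interpret pair_graph G by fact
  show ?thesis using assms(2) arcs_symmetric by (auto simp: near_def)
qed

lemma near2_sym: "pair_graph G \<Longrightarrow> near2 G u v \<Longrightarrow> near2 G v u"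
  unfolding near2_def using near_sym by metis

lemma near_imp_pverts:
  assumes "pair_graph G" "near G u v"
  shows "u \<in> pverts G" "v \<in> pverts G"
proof -
  interpret pair_graph G by fact
  show "u \<in> pverts G" "v \<in> pverts G"
    using assms(2) by (auto simp: near_def dest: wellformed')
qed

lemma near_imp_near2: "pair_graph G \<Longrightarrow> near G u v \<Longrightarrow> near2 G u v"
  unfolding near2_def by (meson near_def near_imp_pverts(2))

lemma graph_dist_le_1_iff:
  assumes "pair_graph G"
  shows "graph_dist G u v \<le> 1 \<longleftrightarrow> near G u v"
proof -
  interpret pair_graph G by fact
  have "(\<exists>p. awalk u p v \<and> length p \<le> 1) \<longleftrightarrow> near G u v"
  proof
    assume "\<exists>p. awalk u p v \<and> length p \<le> 1"
    then obtain p where "awalk u p v" "length p \<le> 1" by blast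
    then show "near G u v"
      by (cases p) (auto simp: near_def awalk_Nil_iff awalk_Cons_iff)
  next
    assume "near G u v"
    then consider "awalk u [] v" | "awalk u [(u, v)] v"
      by (auto simp: near_def awalk_Nil_iff awalk_Cons_iff dest: wellformed')
    then show "\<exists>p. awalk u p v \<and> length p \<le> 1"
      by cases force+
  qed
  then show ?thesis
    using graph_dist_le_iff[OF assms, of u v 1] by (simp add: one_ereal_def)
qed

lemma graph_dist_le_2_iff:
  assumes "pair_graph G"
  shows "graph_dist G u v \<le> 2 \<longleftrightarrow> near2 G u v"
proof -
  interpret pair_graph G by fact
  have "(\<exists>p. awalk u p v \<and> length p \<le> 2) \<longleftrightarrow> near2 G u v"
  proof
    assume "\<exists>p. awalk u p v \<and> length p \<le> 2"
    then obtain p where p: "awalk u p v" "length p \<le> 2" by blast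
    show "near2 G u v"
    proof (cases p)
      case Nil
      with p show ?thesis by (auto simp: near2_def near_def awalk_Nil_iff)
    next
      case (Cons e q)
      with p have e: "e \<in> parcs G" "fst e = u" and q: "awalk (snd e) q v" "length q \<le> 1"
        by (auto simp: awalk_Cons_iff)
      have "near G (snd e) v"
        using q graph_dist_le_1_iff[OF assms, of "snd e" v]
          graph_dist_le_iff[OF assms, of "snd e" v 1] by (auto simp: one_ereal_def)
      moreover have "near G u (snd e)"
        using e by (auto simp: near_def)
      ultimately show ?thesis by (auto simp: near2_def)
    qed
  next
    assume "near2 G u v"
    then obtain w where w: "near G u w" "near G w v" by (auto simp: near2_def)
    have "\<exists>p. awalk x p y \<and> length p \<le> 1" if "near G x y" for x y
      using that graph_dist_le_1_iff[OF assms, of x y] graph_dist_le_iff[OF assms, of x y 1]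
      by (simp add: one_ereal_def)
    with w obtain p q where "awalk u p w" "length p \<le> 1" "awalk w q v" "length q \<le> 1"
      by meson
    then have "awalk u (p @ q) v" "length (p @ q) \<le> 2" by auto
    then show "\<exists>p. awalk u p v \<and> length p \<le> 2" by blast
  qed
  then show ?thesis
    using graph_dist_le_iff[OF assms, of u v 2] by simp
qed

text \<open>The required minimum distance 2 * 1 + 1 is the successor of 2.\<close>

lemma error_correcting_1_iff:
  assumes "pair_graph G"
  shows "error_correcting G 1 D \<longleftrightarrow>
    D \<subseteq> pverts G \<and> (\<forall>x\<in>D. \<forall>y\<in>D. x \<noteq> y \<longrightarrow> \<not> near2 G x y)"
  using Suc_le_graph_dist_iff[OF assms, of 2] graph_dist_le_2_iff[OF assms]
  by (simp add: error_correcting_def)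

section \<open>Covering radius and maximal codes\<close>

lemma covering_radius_eq_2:
  assumes G: "pair_graph G"
    and cov: "\<And>u. u \<in> pverts G \<Longrightarrow> \<exists>c\<in>D. near2 G u c"
    and v: "v \<in> pverts G" "\<And>c. c \<in> D \<Longrightarrow> \<not> near G v c"
  shows "covering_radius G D = enat 2"
  unfolding covering_radius_def
proof (intro antisym Inf_lower Inf_greatest)
  show "enat 2 \<in> {enat r |r. \<forall>v\<in>pverts G. \<exists>c\<in>D. graph_dist G v c \<le> ereal (real r)}"
    using cov graph_dist_le_2_iff[OF G] by simp
next
  fix x
  assume "x \<in> {enat r |r. \<forall>v\<in>pverts G. \<exists>c\<in>D. graph_dist G v c \<le> ereal (real r)}"
  then obtain r c where x: "x = enat r" and c: "c \<in> D" "graph_dist G v c \<le> ereal (real r)"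
    using v(1) by blast
  have "\<not> r \<le> 1"
  proof
    assume "r \<le> 1"
    then have "ereal (real r) \<le> 1" by (simp add: one_ereal_def)
    with c(2) have "graph_dist G v c \<le> 1" by (rule order_trans)
    with c(1) v(2) graph_dist_le_1_iff[OF G] show False by blast
  qed
  with x show "enat 2 \<le> x" by simp
qed

lemma quasi_perfect_code_if_blocked_vertex:
  assumes G: "pair_graph G"
    and S: "error_correcting G 1 S"
    and v: "v \<in> pverts G" "\<And>s. s \<in> S \<Longrightarrow> \<not> near G v s"
    and blocked: "\<And>u. near G v u \<Longrightarrow> \<exists>s\<in>S. near2 G u s"
  shows "\<exists>D. quasi_perfect G 1 D"
proof -
  interpret pair_graph G by fact
  \<comment> \<open>A finite graph has finitely many codes, so some inclusion-maximal code contains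
    \<open>S\<close>.\<close>
  have "finite {D. error_correcting G 1 D}"
    by (rule finite_subset[of _ "Pow (pverts G)"])
      (auto simp: error_correcting_def pair_finite_verts)
  from finite_has_maximal2[OF this, of S] S
  obtain D where D: "error_correcting G 1 D" "S \<subseteq> D"
    and max: "\<And>D'. error_correcting G 1 D' \<Longrightarrow> D \<subseteq> D' \<Longrightarrow> D = D'"
    by auto
  have "\<exists>c\<in>D. near2 G u c" if u: "u \<in> pverts G" for u
  proof (rule ccontr)
    assume far: "\<not> ?thesis"
    then have "error_correcting G 1 (insert u D)"
      using D(1) u near2_sym[OF G] unfolding error_correcting_1_iff[OF G] by blast
    then have "u \<in> D" using max[of "insert u D"] by blast
    \<comment> \<open>\<open>near2\<close> is reflexive on vertices, so \<open>u\<close> itself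
      would be a codeword within distance 2 of \<open>u\<close>.\<close>
    then show False using far u by (auto simp: near2_def near_def)
  qed
  \<comment> \<open>A codeword \<open>c\<close> near \<open>v\<close> would be within distance 2 of
    some \<open>s\<close> in \<open>S\<close>. Since \<open>v\<close> is not near \<open>s\<close>,
    these are two distinct elements of \<open>D\<close>, too close together.\<close>
  moreover have "\<not> near G v c" if c: "c \<in> D" for c
  proof
    assume near: "near G v c"
    then obtain s where s: "s \<in> S" "near2 G c s"
      using blocked by blast
    with v(2) near have "c \<noteq> s" by metis
    then show False
      using c s D error_correcting_1_iff[OF G, of D] by (meson subsetD)
  qed
  ultimately have "covering_radius G D = enat 2"
    using v(1) by (intro covering_radius_eq_2[OF G, of D v])
  with D(1) show ?thesis unfolding quasi_perfect_def one_add_one by blast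
qed

section \<open>The blocked vertex in a product of three graphs\<close>

lemma pverts_cart_prod: "pverts (G \<box> H) = pverts G \<times> pverts H"
  by (simp add: cart_prod_def)

lemma near_cart_prod_iff:
  "near (G \<box> H) (g, h) (g', h') \<longleftrightarrow>
    near G g g' \<and> h \<in> pverts H \<and> h = h' \<or> g \<in> pverts G \<and> g = g' \<and> near H h h'"
  by (auto simp: near_def cart_prod_def)

text \<open>Each step changes at most one of the three coordinates, so two steps leave one
  unchanged.\<close>

lemma near2_cart_prod_imp_coordinate_eq:
  assumes "near2 (A \<box> B \<box> C) ((a, b), c) ((a', b'), c')"
  shows "a = a' \<or> b = b' \<or> c = c'"
  using assms by (auto simp: near2_def near_cart_prod_iff)

lemma quasi_perfect_code_cart_prod3:
  assumes G: "pair_graph A" "pair_graph B" "pair_graph C"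
    and A: "\<And>x. (a, x) \<in> parcs A \<longleftrightarrow> x = a1 \<or> x = a2" "a1 \<noteq> a2"
    and B: "\<And>x. (b, x) \<in> parcs B \<longleftrightarrow> x = b1 \<or> x = b2" "b1 \<noteq> b2"
    and C: "\<And>x. (c, x) \<in> parcs C \<longleftrightarrow> x = c1 \<or> x = c2" "c1 \<noteq> c2"
  shows "\<exists>D. quasi_perfect (A \<box> B \<box> C) 1 D"
proof -
  interpret A: pair_graph A by fact
  interpret B: pair_graph B by fact
  interpret C: pair_graph C by fact
  let ?G = "A \<box> B \<box> C"
  \<comment> \<open>With index 2 read as +1 and index 1 as -1, this is the three-element pattern
    around the origin.\<close>
  let ?S = "{((a2, b2), c), ((a1, b), c2), ((a, b1), c1)}"
  have G3: "pair_graph ?G" using G by (intro pair_graph_cart_prod)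
  have verts: "a \<in> pverts A" "a1 \<in> pverts A" "a2 \<in> pverts A"
    "b \<in> pverts B" "b1 \<in> pverts B" "b2 \<in> pverts B"
    "c \<in> pverts C" "c1 \<in> pverts C" "c2 \<in> pverts C"
    using A(1)[of a1] A(1)[of a2] B(1)[of b1] B(1)[of b2] C(1)[of c1] C(1)[of c2]
    by (auto dest: A.wellformed' B.wellformed' C.wellformed')
  have neq: "a \<noteq> a1" "a \<noteq> a2" "b \<noteq> b1" "b \<noteq> b2" "c \<noteq> c1" "c \<noteq> c2"
    using A(1)[of a] B(1)[of b] C(1)[of c]
    by (auto dest: A.pair_no_loops B.pair_no_loops C.pair_no_loops)
  have near_centre: "near A a x \<longleftrightarrow> x = a \<or> x = a1 \<or> x = a2"
    "near B b y \<longleftrightarrow> y = b \<or> y = b1 \<or> y = b2"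
    "near C c z \<longleftrightarrow> z = c \<or> z = c1 \<or> z = c2" for x y z
    using A(1) B(1) C(1) verts by (auto simp: near_def)
  \<comment> \<open>The first six facts join each neighbour of the centre to an element of
    \<open>?S\<close>. The seventh, followed by the first, leads from the centre itself to
    \<open>((a2, b2), c)\<close> in two steps.\<close>
  have step: "near ?G ((a, b2), c) ((a2, b2), c)" "near ?G ((a2, b), c) ((a2, b2), c)"
    "near ?G ((a1, b), c) ((a1, b), c2)" "near ?G ((a, b), c2) ((a1, b), c2)"
    "near ?G ((a, b1), c) ((a, b1), c1)" "near ?G ((a, b), c1) ((a, b1), c1)"
    "near ?G ((a, b), c) ((a, b2), c)"
    using verts by (simp_all add: near_cart_prod_iff near_centre pverts_cart_prod)
  show ?thesis
  proof (rule quasi_perfect_code_if_blocked_vertex[OF G3, of ?S "((a, b), c)"])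
    show "error_correcting ?G 1 ?S"
      unfolding error_correcting_1_iff[OF G3]
    proof
      show "?S \<subseteq> pverts ?G"
        using verts by (simp add: pverts_cart_prod)
      show "\<forall>x\<in>?S. \<forall>y\<in>?S. x \<noteq> y \<longrightarrow> \<not> near2 ?G x y"
        using neq A(2) B(2) C(2) by (auto dest: near2_cart_prod_imp_coordinate_eq)
    qed
    show "((a, b), c) \<in> pverts ?G"
      using verts by (simp add: pverts_cart_prod)
    show "\<not> near ?G ((a, b), c) s" if "s \<in> ?S" for s
      using that neq by (auto simp: near_cart_prod_iff)
    show "\<exists>s\<in>?S. near2 ?G u s" if u: "near ?G ((a, b), c) u" for u
    proof (cases "u = ((a, b), c)")
      case True
      then show ?thesis using step(1,7) by (auto simp: near2_def)
    next
      case False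
      then have "u \<in> {((a1, b), c), ((a2, b), c), ((a, b1), c), ((a, b2), c),
          ((a, b), c1), ((a, b), c2)}"
        using u by (cases u) (auto simp: near_cart_prod_iff near_centre)
      then have "\<exists>s\<in>?S. near ?G u s" using step by auto
      then show ?thesis using near_imp_near2[OF G3] by blast
    qed
  qed
qed

section \<open>Instantiation with cycles\<close>

text \<open>Vertex 1 serves as the centre in each cycle: for \<open>n \<ge> 3\<close> its two
  neighbours are reached without wrapping around.\<close>

lemma parcs_cycle_graph_1_iff:
  assumes "n \<ge> 3"
  shows "(1, x) \<in> parcs (cycle_graph n) \<longleftrightarrow> x = 0 \<or> x = 2"
proof -
  \<comment> \<open>Wrapping around occurs only for \<open>Suc x = n\<close>, where the remainder is
    0 instead of 1.\<close>
  have "x = 0" if "x < n" "1 = Suc x mod n"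
    using that assms by (cases "Suc x = n") auto
  then show ?thesis using assms by (auto simp: cycle_graph_def)
qed

lemma quasi_perfect_code_three_cycles:
  assumes "l \<ge> 3" "m \<ge> 3" "n \<ge> 3"
  shows "\<exists>D. quasi_perfect (cycle_graph l \<box> cycle_graph m \<box> cycle_graph n) 1 D"
  by (rule quasi_perfect_code_cart_prod3[where a = 1 and b = 1 and c = 1 and ?a1.0 = 0
        and ?a2.0 = 2 and ?b1.0 = 0 and ?b2.0 = 2 and ?c1.0 = 0 and ?c2.0 = 2])
    (simp_all add: assms pair_graph_cycle_graph parcs_cycle_graph_1_iff[unfolded One_nat_def])

theorem theorem10:
  fixes k :: nat
  assumes "k \<ge> 1"
  shows "(\<exists>D. quasi_perfect (cycle_graph 6 \<box> cycle_graph 6 \<box> cycle_graph (3 * k)) 1 D) \<and>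
    (\<forall>n. 8 \<le> n \<and> n \<le> 12 \<longrightarrow>
      (\<exists>D. quasi_perfect (cycle_graph n \<box> cycle_graph n \<box> cycle_graph (3 * k)) 1 D)) \<and>
    (\<forall>n. 8 \<le> n \<and> n \<le> 12 \<longrightarrow>
      (\<exists>D. quasi_perfect (cycle_graph n \<box> cycle_graph n \<box> cycle_graph n) 1 D))"
  \<comment> \<open>Every cycle length that occurs is at least 3; for \<open>3 * k\<close> this
    follows from \<open>k \<ge> 1\<close>.\<close>
  using assms by (intro conjI allI impI quasi_perfect_code_three_cycles) auto

end
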